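(* Let $d\ge1$, let $\rho\in(0,1)^d$ with $|\rho|<1$, let $N$ be a positive integer and $n\in\{0,1,\ldots,N\}$. Then for all $x,y\in\mathbb{Z}_N^{d+1}$, $$\mathsf{P}_n(\mathsf{K}_{\rho,N};x,y)=\frac{(-N)_n}{n!}\sum_{k=0}^n\frac{(-n)_k}{(-N)_k(-N)_k}\,\mathcal{F}_k(x,y;\rho).$$
   Context: Notation: $(a)_k=a(a+1)\cdots(a+k-1)$; for vectors, $|\cdot|$ is the sum of the components, $\gamma!=\prod_i\gamma_i!$, $(-x)_\gamma=\prod_i(-x_i)_{\gamma_i}$. $\mathbb{Z}_N^{d+1}=\{\alpha\in\mathbb{N}_0^{d+1}:|\alpha|=N\}$. Put $\boldsymbol\rho=(\rho_1,\ldots,\rho_d,1-|\rho|)$ and $\boldsymbol\rho^\gamma=\prod_{i=1}^{d+1}\boldsymbol\rho_i^{\gamma_i}$. Krawtchouck inner product of functions on $\mathbb{Z}_N^{d+1}$: $$\langle f,g\rangle_{\mathsf{K}_{\rho,N}}=N!\sum_{\alpha\in\mathbb{Z}_N^{d+1}}f(\alpha)g(\alpha)\frac{\boldsymbol\rho^\alpha}{\alpha!},$$ normalized so that $\langle1,1\rangle=1$. A polynomial on $\mathbb{Z}_N^{d+1}$ of degree at most $n$ is the restriction of a polynomial of total degree at most $n$ in the first $d$ coordinates. For $0\le n\le N$, $\mathcal{V}_n^d(\mathsf{K}_{\rho,N})$ is the space of polynomials of degree at most $n$ on $\mathbb{Z}_N^{d+1}$ orthogonal to all polynomials of degree at most $n-1$.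 $\mathsf{P}_n(\mathsf{K}_{\rho,N};x,y)$ is the reproducing kernel of $\mathcal{V}_n^d(\mathsf{K}_{\rho,N})$: it lies in $\mathcal{V}_n^d(\mathsf{K}_{\rho,N})$ in each variable and $\langle\mathsf{P}_n(\mathsf{K}_{\rho,N};x,\cdot),Q\rangle_{\mathsf{K}_{\rho,N}}=Q(x)$ for all $Q\in\mathcal{V}_n^d(\mathsf{K}_{\rho,N})$. For $x,y\in\mathbb{Z}_N^{d+1}$, $\mathcal{F}_0(x,y;\rho)=1$ and $$\mathcal{F}_k(x,y;\rho)=\sum_{\gamma\in\mathbb{N}_0^{d+1},\,|\gamma|=k}\frac{(-x)_\gamma(-y)_\gamma}{\boldsymbol\rho^\gamma\,\gamma!}.$$ *)

theory Defs
  imports "HOL-Analysis.Analysis"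
begin

text \<open>
  A vector with \<open>m\<close> components is a function on \<open>nat\<close> whose components are the values at
  \<open>0, ..., m - 1\<close>. Multi-indices are required to vanish elsewhere, so that each one has a
  single representative and the index sets are finite.

  Functions on \<open>simplex_grid d N\<close> are total functions of which only the values on that set
  matter: every notion below depends on nothing else.
\<close>

text \<open>
  The set \<open>Z_N^{d+1}\<close>: the \<open>d + 1\<close> coordinates are \<open>0, ..., d\<close>, the last one being \<open>d\<close>. The same
  set with \<open>N\<close> replaced by \<open>k\<close> is the range of the sum that defines \<open>calF\<close>.
\<close>

definition simplex_grid :: "nat \<Rightarrow> nat \<Rightarrow> (nat \<Rightarrow> nat) set" where
  "simplex_grid d N = {\<alpha>. (\<forall>i>d. \<alpha> i = 0) \<and> (\<Sum>i\<le>d. \<alpha> i) = N}"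

definition bold_rho :: "nat \<Rightarrow> (nat \<Rightarrow> real) \<Rightarrow> nat \<Rightarrow> real" where
  "bold_rho d \<rho> i = (if i < d then \<rho> i else 1 - (\<Sum>j<d. \<rho> j))"

definition rho_power :: "nat \<Rightarrow> (nat \<Rightarrow> real) \<Rightarrow> (nat \<Rightarrow> nat) \<Rightarrow> real" where
  "rho_power d \<rho> \<gamma> = (\<Prod>i\<le>d. bold_rho d \<rho> i ^ \<gamma> i)"

definition multi_fact :: "nat \<Rightarrow> (nat \<Rightarrow> nat) \<Rightarrow> real" where
  "multi_fact d \<gamma> = (\<Prod>i\<le>d. fact (\<gamma> i))"

definition multi_poch_minus :: "nat \<Rightarrow> (nat \<Rightarrow> nat) \<Rightarrow> (nat \<Rightarrow> nat) \<Rightarrow> real" where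
  "multi_poch_minus d x \<gamma> = (\<Prod>i\<le>d. pochhammer (- real (x i)) (\<gamma> i))"

definition krawtchouk_inner ::
  "nat \<Rightarrow> (nat \<Rightarrow> real) \<Rightarrow> nat \<Rightarrow> ((nat \<Rightarrow> nat) \<Rightarrow> real) \<Rightarrow> ((nat \<Rightarrow> nat) \<Rightarrow> real) \<Rightarrow> real" where
  "krawtchouk_inner d \<rho> N f g =
     fact N * (\<Sum>\<alpha>\<in>simplex_grid d N. f \<alpha> * g \<alpha> * (rho_power d \<rho> \<alpha> / multi_fact d \<alpha>))"

definition exponents_upto :: "nat \<Rightarrow> nat \<Rightarrow> (nat \<Rightarrow> nat) set" where
  "exponents_upto d n = {\<beta>. (\<forall>i\<ge>d. \<beta> i = 0) \<and> (\<Sum>i<d. \<beta> i) \<le> n}"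

text \<open>Functions whose restriction to the grid is that of a real polynomial of total degree at
  most \<open>n\<close> in the first \<open>d\<close> coordinates.\<close>

definition grid_polys :: "nat \<Rightarrow> nat \<Rightarrow> nat \<Rightarrow> ((nat \<Rightarrow> nat) \<Rightarrow> real) set" where
  "grid_polys d N n =
     {f. \<exists>c :: (nat \<Rightarrow> nat) \<Rightarrow> real. \<forall>x\<in>simplex_grid d N.
           f x = (\<Sum>\<beta>\<in>exponents_upto d n. c \<beta> * (\<Prod>i<d. real (x i) ^ \<beta> i))}"

text \<open>Quantifying over \<open>m < n\<close> instead of taking degree at most \<open>n - 1\<close> makes the orthogonality
  condition void for \<open>n = 0\<close>, where truncated subtraction would be wrong.\<close>

definition krawtchouk_space ::
  "nat \<Rightarrow> (nat \<Rightarrow> real) \<Rightarrow> nat \<Rightarrow> nat \<Rightarrow> ((nat \<Rightarrow> nat) \<Rightarrow> real) set" where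
  "krawtchouk_space d \<rho> N n =
     {f \<in> grid_polys d N n. \<forall>m<n. \<forall>g\<in>grid_polys d N m. krawtchouk_inner d \<rho> N f g = 0}"

definition is_reproducing_kernel ::
  "nat \<Rightarrow> (nat \<Rightarrow> real) \<Rightarrow> nat \<Rightarrow> nat \<Rightarrow> ((nat \<Rightarrow> nat) \<Rightarrow> (nat \<Rightarrow> nat) \<Rightarrow> real) \<Rightarrow> bool" where
  "is_reproducing_kernel d \<rho> N n P \<longleftrightarrow>
     (\<forall>x\<in>simplex_grid d N. (\<lambda>y. P x y) \<in> krawtchouk_space d \<rho> N n) \<and>
     (\<forall>y\<in>simplex_grid d N. (\<lambda>x. P x y) \<in> krawtchouk_space d \<rho> N n) \<and>
     (\<forall>Q\<in>krawtchouk_space d \<rho> N n. \<forall>x\<in>simplex_grid d N.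
        krawtchouk_inner d \<rho> N (\<lambda>y. P x y) Q = Q x)"

text \<open>The values of the kernel off the grid are fixed to be \<open>0\<close>; this is what makes the
  description definite.\<close>

definition krawtchouk_kernel ::
  "nat \<Rightarrow> (nat \<Rightarrow> real) \<Rightarrow> nat \<Rightarrow> nat \<Rightarrow> (nat \<Rightarrow> nat) \<Rightarrow> (nat \<Rightarrow> nat) \<Rightarrow> real" where
  "krawtchouk_kernel d \<rho> N n =
     (THE P. is_reproducing_kernel d \<rho> N n P \<and>
        (\<forall>x y. x \<notin> simplex_grid d N \<or> y \<notin> simplex_grid d N \<longrightarrow> P x y = 0))"

definition calF ::
  "nat \<Rightarrow> (nat \<Rightarrow> real) \<Rightarrow> nat \<Rightarrow> (nat \<Rightarrow> nat) \<Rightarrow> (nat \<Rightarrow> nat) \<Rightarrow> real" where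
  "calF d \<rho> k x y =
     (\<Sum>\<gamma>\<in>simplex_grid d k.
        multi_poch_minus d x \<gamma> * multi_poch_minus d y \<gamma> / (rho_power d \<rho> \<gamma> * multi_fact d \<gamma>))"

lemma finite_simplex_grid: "finite (simplex_grid d N)"
proof (rule finite_subset)
  show "simplex_grid d N \<subseteq> {f. (\<forall>i. (i \<in> {..d} \<longrightarrow> f i \<in> {..N}) \<and> (i \<notin> {..d} \<longrightarrow> f i = 0))}"
    by (auto simp: simplex_grid_def intro: member_le_sum)
  show "finite {f. (\<forall>i. (i \<in> {..d} \<longrightarrow> f i \<in> {..N}) \<and> (i \<notin> {..d} \<longrightarrow> f i = (0::nat)))}"
    by (rule finite_set_of_finite_funs) auto
qed

lemma finite_exponents_upto: "finite (exponents_upto d n)"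
proof (rule finite_subset)
  have "\<beta> i \<le> n" if "(\<Sum>i<d. \<beta> i) \<le> n" "i < d" for \<beta> :: "nat \<Rightarrow> nat" and i
    using that member_le_sum[of i "{..<d}" \<beta>] by force
  then show "exponents_upto d n \<subseteq>
      {f. (\<forall>i. (i \<in> {..<d} \<longrightarrow> f i \<in> {..n}) \<and> (i \<notin> {..<d} \<longrightarrow> f i = 0))}"
    by (auto simp: exponents_upto_def)
  show "finite {f. (\<forall>i. (i \<in> {..<d} \<longrightarrow> f i \<in> {..n}) \<and> (i \<notin> {..<d} \<longrightarrow> f i = (0::nat)))}"
    by (rule finite_set_of_finite_funs) auto
qed

lemma calF_0: "calF d \<rho> 0 x y = 1"
proof -
  have "simplex_grid d 0 = {\<lambda>_. 0}"
    by (auto simp: simplex_grid_def fun_eq_iff) (metis atMost_iff not_le)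
  then show ?thesis
    by (simp add: calF_def multi_poch_minus_def rho_power_def multi_fact_def)
qed

end

theory Submission
  imports Defs
begin

text \<open>
  In each variable the right-hand side is a polynomial of degree at most \<open>n\<close>, so only orthogonality
  and the reproducing property need an argument. Integrate it against the products
  \<open>g\<^sub>\<beta>(y) = (-y)\<^sub>\<beta>\<close>, \<open>|\<beta>| = m \<le> n\<close>, which span the polynomials. The product rule for Pochhammer
  symbols reduces \<open>\<langle>F\<^sub>k(x,\<cdot>), g\<^sub>\<beta>\<rangle>\<close> to the moments \<open>\<langle>1, g\<^sub>e\<rangle> = (-N)\<^sub>|\<^sub>e\<^sub>| \<rho>\<^sup>e\<close> and turns it into a
  combination of \<open>g\<^sub>\<delta>(x)\<close>, \<open>\<delta> \<le> \<beta>\<close>. After summation over \<open>k\<close> the scalar factor of \<open>g\<^sub>\<delta>(x)\<close> is the \<open>n\<close>-th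
  finite difference of \<open>k \<mapsto> (-k)\<^sub>j (k-N)\<^sub>m\<^sub>-\<^sub>j\<close>, \<open>j = |\<delta>|\<close>. This polynomial has degree \<open>m\<close>, so everything
  vanishes if \<open>m < n\<close>; if \<open>m = n\<close>, the result is \<open>g\<^sub>\<beta>(x)\<close> plus terms of lower degree. Hence for \<open>Q\<close> in
  the Krawtchouk space the difference between \<open>Q\<close> and its image under the kernel belongs to that space
  and is orthogonal to it.
\<close>

section \<open>Pochhammer symbols and finite differences\<close>

text \<open>Induction on \<open>b\<close>, multiplying by
  \<open>z + b = (z + c + b - j) + (j - c)\<close>: the first summand lengthens the symbol in
  \<open>z\<close>, the second the one in \<open>-c\<close>, and Pascal's rule merges the two sums.
  The coefficients are again Pochhammer symbols at a negated natural number, now \<open>c\<close>,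
  which later makes the sum over multi-indices computable.\<close>

lemma pochhammer_mult_pochhammer:
  fixes z :: "'a::comm_ring_1"
  shows "pochhammer z c * pochhammer z b =
    (\<Sum>j\<le>b. of_nat (b choose j) * pochhammer (- of_nat c) j * pochhammer z (c + b - j))"
proof (induction b)
  case 0
  then show ?case by simp
next
  case (Suc b)
  let ?p = "\<lambda>j. pochhammer (- of_nat c :: 'a) j"
  have step: "pochhammer z (c + b - j) * (z + of_nat b) * ?p j =
      ?p j * pochhammer z (c + Suc b - j) + ?p (Suc j) * pochhammer z (c + b - j)" if "j \<le> b" for j
  proof -
    have e: "c + Suc b - j = Suc (c + b - j)" using that by simp
    have n: "(of_nat (c + b - j) :: 'a) = of_nat c + of_nat b - of_nat j"
      using that by (simp add: of_nat_diff)
    show ?thesis unfolding e pochhammer_Suc n by (simp add: algebra_simps)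
  qed
  have "pochhammer z c * pochhammer z (Suc b) =
      (\<Sum>j\<le>b. of_nat (b choose j) * ?p j * pochhammer z (c + b - j)) * (z + of_nat b)"
    unfolding Suc.IH[symmetric] by (simp add: pochhammer_Suc mult.assoc)
  also have "\<dots> = (\<Sum>j\<le>b. of_nat (b choose j) *
      (?p j * pochhammer z (c + Suc b - j) + ?p (Suc j) * pochhammer z (c + b - j)))"
    unfolding sum_distrib_right
    by (rule sum.cong[OF refl]) (simp only: step[symmetric] atMost_iff mult_ac)
  also have "\<dots> = (\<Sum>j\<le>b. of_nat (b choose j) * ?p j * pochhammer z (c + Suc b - j)) +
      (\<Sum>j\<le>b. of_nat (b choose j) * ?p (Suc j) * pochhammer z (c + b - j))"
    by (simp add: sum.distrib algebra_simps)
  also have "(\<Sum>j\<le>b. of_nat (b choose j) * ?p j * pochhammer z (c + Suc b - j)) =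
      (\<Sum>j\<le>Suc b. of_nat (b choose j) * ?p j * pochhammer z (c + Suc b - j))"
    by (simp add: binomial_eq_0)
  also have "\<dots> = pochhammer z (c + Suc b) +
      (\<Sum>j\<le>b. of_nat (b choose Suc j) * ?p (Suc j) * pochhammer z (c + b - j))"
    by (subst sum.atMost_Suc_shift) simp
  finally show ?case
    by (subst sum.atMost_Suc_shift) (simp add: sum.distrib algebra_simps)
qed

lemma pochhammer_minus_nat:
  "pochhammer (- real a) e = (-1) ^ e * fact e * real (a choose e)"
  by (simp add: binomial_gbinomial gbinomial_pochhammer power_mult_distrib[symmetric])

text \<open>In terms of generating functions: weighting the coefficients \<open>1 / a!\<close> of
  the exponential series by \<open>(-a)_e\<close> multiplies the series by
  \<open>(-1)^e X^e\<close>.\<close>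

lemma pochhammer_minus_nat_over_fact:
  "pochhammer (- real a) e / fact a = (if a < e then 0 else (-1) ^ e / fact (a - e))"
  by (auto simp: pochhammer_minus_nat binomial_fact field_simps)

lemma pochhammer_minus_nat_nonzero: "k \<le> N \<Longrightarrow> pochhammer (- real N) k \<noteq> 0"
  by (simp add: pochhammer_minus_nat)

text \<open>Up to the sign \<open>(-1)^n\<close>, the \<open>n\<close>-th forward difference of
  \<open>f\<close> at 0.\<close>

definition alt_binomial_sum :: "nat \<Rightarrow> (nat \<Rightarrow> real) \<Rightarrow> real" where
  "alt_binomial_sum n f = (\<Sum>k\<le>n. (-1) ^ k * real (n choose k) * f k)"

lemma alt_binomial_sum_Suc:
  "alt_binomial_sum (Suc n) f = alt_binomial_sum n f - alt_binomial_sum n (\<lambda>k. f (Suc k))"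
proof -
  have "alt_binomial_sum (Suc n) f = f 0 +
      (\<Sum>k\<le>n. - ((-1) ^ k * real (n choose Suc k) * f (Suc k)) - (-1) ^ k * real (n choose k) * f (Suc k))"
    unfolding alt_binomial_sum_def
    by (subst sum.atMost_Suc_shift) (simp, rule sum.cong, simp_all add: algebra_simps)
  moreover have "alt_binomial_sum n f = (\<Sum>k\<le>Suc n. (-1) ^ k * real (n choose k) * f k)"
    by (simp add: alt_binomial_sum_def binomial_eq_0)
  then have "alt_binomial_sum n f = f 0 + (\<Sum>k\<le>n. - ((-1) ^ k * real (n choose Suc k) * f (Suc k)))"
    by (subst (asm) sum.atMost_Suc_shift) simp
  ultimately show ?thesis
    by (simp only: alt_binomial_sum_def[of n "\<lambda>k. f (Suc k)"] sum_subtractf)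
qed

text \<open>Absorption, \<open>(k+1) C(n+1, k+1) = (n+1) C(n, k)\<close>, trades a factor
  \<open>k\<close> for one order of differencing and a shift of \<open>f\<close>.\<close>

lemma alt_binomial_sum_mult:
  "alt_binomial_sum (Suc n) (\<lambda>k. real k * f k) = - real (Suc n) * alt_binomial_sum n (\<lambda>k. f (Suc k))"
proof -
  have "real (Suc n choose Suc k) * real (Suc k) = real (Suc n) * real (n choose k)" for k
    by (metis Suc_times_binomial mult.commute of_nat_mult)
  then have e: "(-1) ^ Suc k * real (Suc n choose Suc k) * (real (Suc k) * f (Suc k)) =
      - real (Suc n) * ((-1) ^ k * real (n choose k) * f (Suc k))" for k
    by (metis (no_types, opaque_lifting) mult.assoc mult.commute mult_minus_left mult_1 power_Suc)
  show ?thesis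
    unfolding alt_binomial_sum_def
    by (subst sum.atMost_Suc_shift) (simp only: e sum_distrib_left mult_zero_left mult_zero_right of_nat_0 add_0)
qed

text \<open>The shift \<open>s\<close> makes the property stable under \<open>f \<mapsto> f \<circ> Suc\<close>, which the induction on \<open>n\<close> needs.\<close>

definition alt_annihilated :: "nat \<Rightarrow> (nat \<Rightarrow> real) \<Rightarrow> bool" where
  "alt_annihilated n f \<longleftrightarrow> (\<forall>s. alt_binomial_sum n (\<lambda>k. f (k + s)) = 0)"

lemma alt_annihilated_mult_affine:
  assumes "alt_annihilated n f"
  shows "alt_annihilated (Suc n) (\<lambda>k. (a + b * real k) * f k)"
  unfolding alt_annihilated_def
proof
  fix s
  \<comment> \<open>Two shifts are needed: a difference of order \<open>n + 1\<close> splits into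
    those of order \<open>n\<close> at \<open>s\<close> and \<open>s + 1\<close>, and absorption
    leaves one at \<open>s + 1\<close>.\<close>
  have 0: "alt_binomial_sum n (\<lambda>k. f (k + s)) = 0" "alt_binomial_sum n (\<lambda>k. f (Suc k + s)) = 0"
    using assms[unfolded alt_annihilated_def, rule_format, of s]
      assms[unfolded alt_annihilated_def, rule_format, of "Suc s"] by simp_all
  have "alt_binomial_sum (Suc n) (\<lambda>k. (a + b * real (k + s)) * f (k + s)) =
      (a + b * real s) * alt_binomial_sum (Suc n) (\<lambda>k. f (k + s)) +
      b * alt_binomial_sum (Suc n) (\<lambda>k. real k * f (k + s))"
    unfolding alt_binomial_sum_def sum_distrib_left sum.distrib[symmetric]
    by (rule sum.cong) (simp_all add: algebra_simps)
  also have "\<dots> = 0"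
    unfolding alt_binomial_sum_mult by (subst alt_binomial_sum_Suc) (simp only: 0, simp)
  finally show "alt_binomial_sum (Suc n) (\<lambda>k. (a + b * real (k + s)) * f (k + s)) = 0" .
qed

lemma alt_annihilated_pochhammer:
  assumes "alt_annihilated n f"
  shows "alt_annihilated (n + l) (\<lambda>k. pochhammer (a + b * real k) l * f k)"
proof (induction l)
  case (Suc l)
  from alt_annihilated_mult_affine[OF Suc, of "a + real l" b] show ?case
    by (simp add: pochhammer_Suc algebra_simps)
qed (use assms in simp)

lemma alt_annihilated_mono: "alt_annihilated n f \<Longrightarrow> alt_annihilated (n + l) f"
proof (induction l)
  case (Suc l)
  then show ?case using alt_annihilated_mult_affine[of "n + l" f 1 0] by simp
qed simp

lemma alt_binomial_sum_pochhammers: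
  assumes "j + l < n"
  shows "alt_binomial_sum n (\<lambda>k. pochhammer (- real k) j * pochhammer (real k - c) l) = 0"
proof -
  \<comment> \<open>The first difference kills constants, and each of the \<open>l + j\<close>
    affine factors costs one more order; the total \<open>1 + l + j\<close> is at most
    \<open>n\<close>.\<close>
  have "alt_annihilated 1 (\<lambda>_. 1)"
    by (simp add: alt_annihilated_def alt_binomial_sum_def)
  then have "alt_annihilated (1 + l + j)
      (\<lambda>k. pochhammer (0 + -1 * real k) j * (pochhammer (- c + 1 * real k) l * 1))"
    by (intro alt_annihilated_pochhammer)
  from alt_annihilated_mono[OF this, of "n - (1 + l + j)"] assms
  have "alt_annihilated n (\<lambda>k. pochhammer (- real k) j * pochhammer (real k - c) l)"
    by simp
  from this[unfolded alt_annihilated_def, rule_format, of 0] show ?thesis by simp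
qed

section \<open>Sums over the simplex grid\<close>

text \<open>An iterated Cauchy product. It reduces multinomial sums to products of one-variable
  power series with known closed forms.\<close>

lemma sum_simplex_grid_prod:
  fixes h :: "nat \<Rightarrow> nat \<Rightarrow> 'a::comm_ring_1"
  shows "(\<Sum>\<alpha>\<in>simplex_grid d N. \<Prod>i\<le>d. h i (\<alpha> i)) = fps_nth (\<Prod>i\<le>d. Abs_fps (h i)) N"
proof (induction d arbitrary: N)
  case 0
  have "simplex_grid 0 N = {(\<lambda>_. 0)(0 := N)}"
    by (auto simp: simplex_grid_def fun_eq_iff)
  then show ?case by simp
next
  case (Suc d)
  \<comment> \<open>Split off the last coordinate: it is determined by the sum \<open>j\<close> of
    the others, and it is reset to 0 because members of the smaller grid vanish there.\<close>
  have "(\<Sum>\<alpha>\<in>simplex_grid (Suc d) N. \<Prod>i\<le>Suc d. h i (\<alpha> i)) =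
      (\<Sum>(j, \<alpha>)\<in>(SIGMA j:{0..N}. simplex_grid d j). (\<Prod>i\<le>d. h i (\<alpha> i)) * h (Suc d) (N - j))"
  proof (rule sum.reindex_bij_witness[where
        i = "\<lambda>(j, \<alpha>). \<alpha>(Suc d := N - j)" and j = "\<lambda>\<alpha>. (\<Sum>i\<le>d. \<alpha> i, \<alpha>(Suc d := 0))"], goal_cases)
    case (1 \<alpha>)
    then show ?case by (auto simp: simplex_grid_def fun_eq_iff)
  next
    case (2 \<alpha>)
    then show ?case by (auto simp: simplex_grid_def less_Suc_eq_le not_less Suc_le_eq)
  next
    case (3 b)
    then show ?case by (auto simp: simplex_grid_def fun_eq_iff)
  next
    case (4 b)
    then show ?case by (auto simp: simplex_grid_def)
  next
    case (5 \<alpha>)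
    then have "\<alpha> (Suc d) = N - (\<Sum>i\<le>d. \<alpha> i)" by (auto simp: simplex_grid_def)
    then show ?case by simp
  qed
  also have "\<dots> = (\<Sum>j=0..N. (\<Sum>\<alpha>\<in>simplex_grid d j. \<Prod>i\<le>d. h i (\<alpha> i)) * h (Suc d) (N - j))"
    by (subst sum.Sigma[symmetric]) (auto simp: finite_simplex_grid sum_distrib_right)
  finally show ?case
    by (simp add: Suc.IH fps_mult_nth)
qed

lemma prod_fps_const: "(\<Prod>i\<in>A. fps_const (f i)) = fps_const (\<Prod>i\<in>A. f i :: 'a::comm_ring_1)"
  by (induction A rule: infinite_finite_induct) auto

lemma prod_fps_exp: "finite A \<Longrightarrow> (\<Prod>i\<in>A. fps_exp (f i)) = fps_exp (\<Sum>i\<in>A. f i :: real)"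
  by (induction A rule: finite_induct) (auto simp: fps_exp_add_mult)

lemma fps_const_X_power_mult_nth:
  fixes g :: "'a::comm_ring_1 fps"
  shows "fps_nth (fps_const a * fps_X ^ j * g) k = (if k < j then 0 else a * fps_nth g (k - j))"
  by (simp add: mult.assoc fps_X_power_mult_nth)

text \<open>Each coordinate contributes \<open>(-r)^e X^e exp(r X)\<close>. Since the
  \<open>r i\<close> add up to 1, the exponentials multiply to \<open>exp X\<close>, and its shifted
  coefficient is read off with \<open>pochhammer_minus_nat_over_fact\<close>.\<close>

lemma sum_simplex_grid_moment:
  assumes "(\<Sum>i\<le>d. r i) = 1"
  shows "fact N * (\<Sum>\<alpha>\<in>simplex_grid d N. \<Prod>i\<le>d. pochhammer (- real (\<alpha> i)) (e i) / fact (\<alpha> i) * r i ^ \<alpha> i) =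
    pochhammer (- real N) (\<Sum>i\<le>d. e i) * (\<Prod>i\<le>d. r i ^ e i)"
proof -
  have gf: "Abs_fps (\<lambda>a. pochhammer (- real a) e / fact a * r ^ a) =
      fps_const ((- r) ^ e) * fps_X ^ e * fps_exp r" for e and r :: real
    by (rule fps_ext)
      (auto simp: fps_const_X_power_mult_nth pochhammer_minus_nat_over_fact power_minus[of r]
        simp flip: power_add)
  have "(\<Sum>\<alpha>\<in>simplex_grid d N. \<Prod>i\<le>d. pochhammer (- real (\<alpha> i)) (e i) / fact (\<alpha> i) * r i ^ \<alpha> i) =
      fps_nth (fps_const (\<Prod>i\<le>d. (- r i) ^ e i) * fps_X ^ (\<Sum>i\<le>d. e i) * fps_exp 1) N"
    unfolding sum_simplex_grid_prod[where h = "\<lambda>i a. pochhammer (- real a) (e i) / fact a * r i ^ a"] gf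
    by (simp add: assms prod.distrib prod_fps_const prod_fps_exp power_sum)
  also have "\<dots> = pochhammer (- real N) (\<Sum>i\<le>d. e i) / fact N * (\<Prod>i\<le>d. r i ^ e i)"
    unfolding fps_const_X_power_mult_nth
    by (simp add: pochhammer_minus_nat_over_fact power_minus[of "r _"]
        prod.distrib power_sum)
  finally show ?thesis by simp
qed

text \<open>The binomial series of \<open>(1 - X)^(-a)\<close>.\<close>

definition fps_poch :: "real \<Rightarrow> real fps" where
  "fps_poch a = Abs_fps (\<lambda>n. pochhammer a n / fact n)"

text \<open>Coefficientwise this is the Chu-Vandermonde identity.\<close>

lemma fps_poch_add: "fps_poch a * fps_poch b = fps_poch (a + b)"
  by (rule fps_ext)
    (simp add: fps_poch_def fps_mult_nth pochhammer_binomial_sum binomial_fact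
      sum_divide_distrib atMost_atLeast0 field_simps)

lemma prod_fps_poch: "finite A \<Longrightarrow> (\<Prod>i\<in>A. fps_poch (f i)) = fps_poch (\<Sum>i\<in>A. f i)"
proof (induction A rule: finite_induct)
  case empty
  show ?case by (rule fps_ext) (simp add: fps_poch_def pochhammer_0_left)
qed (simp add: fps_poch_add)

text \<open>With \<open>a = - x i\<close> and \<open>e = \<delta> i\<close>, each coordinate
  contributes \<open>(-1)^e (a)_e X^e (1 - X)^(-a-e)\<close>. The exponents combine to
  \<open>N - j\<close>, so \<open>x\<close> survives only through \<open>(-x)_\<delta>\<close>. The
  factor \<open>(-N)_j\<close> is kept on the left because it vanishes for
  \<open>j > N\<close>.\<close>

lemma sum_simplex_grid_pochhammers:
  fixes \<delta> :: "nat \<Rightarrow> nat"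
  assumes x: "x \<in> simplex_grid d N"
  defines "j \<equiv> \<Sum>i\<le>d. \<delta> i"
  shows "pochhammer (- real N) j *
      (\<Sum>\<gamma>\<in>simplex_grid d k. multi_poch_minus d x \<gamma> * multi_poch_minus d \<gamma> \<delta> / multi_fact d \<gamma>) =
    multi_poch_minus d x \<delta> * pochhammer (- real N) k * pochhammer (- real k) j / fact k"
proof -
  have gf: "Abs_fps (\<lambda>c. pochhammer a c * pochhammer (- real c) e / fact c) =
      fps_const ((-1) ^ e * pochhammer a e) * fps_X ^ e * fps_poch (a + real e)" for a e
  proof (rule fps_ext, unfold fps_const_X_power_mult_nth fps_nth_Abs_fps)
    fix c
    have "pochhammer a c * pochhammer (- real c) e / fact c =
        pochhammer a c * (pochhammer (- real c) e / fact c)" by simp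
    also have "\<dots> = (if c < e then 0 else (-1) ^ e * pochhammer a e * fps_nth (fps_poch (a + real e)) (c - e))"
      unfolding pochhammer_minus_nat_over_fact using pochhammer_product[of e c a]
      by (simp add: fps_poch_def)
    finally show "pochhammer a c * pochhammer (- real c) e / fact c = \<dots>" .
  qed
  have N: "(\<Sum>i\<le>d. real (\<delta> i) - real (x i)) = real j - real N"
    using x by (simp add: simplex_grid_def j_def sum.distrib sum_negf sum_subtractf flip: of_nat_sum)
  have "(\<Sum>\<gamma>\<in>simplex_grid d k. multi_poch_minus d x \<gamma> * multi_poch_minus d \<gamma> \<delta> / multi_fact d \<gamma>) =
      (\<Sum>\<gamma>\<in>simplex_grid d k. \<Prod>i\<le>d. pochhammer (- real (x i)) (\<gamma> i) * pochhammer (- real (\<gamma> i)) (\<delta> i) / fact (\<gamma> i))"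
    by (simp add: multi_poch_minus_def multi_fact_def prod.distrib prod_dividef)
  also have "\<dots> = fps_nth (fps_const ((-1) ^ j * multi_poch_minus d x \<delta>) * fps_X ^ j *
      fps_poch (real j - real N)) k"
    unfolding sum_simplex_grid_prod[where h = "\<lambda>i c. pochhammer (- real (x i)) c * pochhammer (- real c) (\<delta> i) / fact c"] gf
    by (simp add: prod.distrib prod_fps_const prod_fps_poch N multi_poch_minus_def j_def power_sum
        del: fps_const_mult)
  finally have s: "(\<Sum>\<gamma>\<in>simplex_grid d k. multi_poch_minus d x \<gamma> * multi_poch_minus d \<gamma> \<delta> / multi_fact d \<gamma>) =
      (if k < j then 0 else (-1) ^ j * multi_poch_minus d x \<delta> * (pochhammer (real j - real N) (k - j) / fact (k - j)))"
    unfolding fps_const_X_power_mult_nth by (simp add: fps_poch_def)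
  have "multi_poch_minus d x \<delta> * pochhammer (- real N) k * pochhammer (- real k) j / fact k =
      multi_poch_minus d x \<delta> * pochhammer (- real N) k * (pochhammer (- real k) j / fact k)"
    by simp
  \<comment> \<open>For \<open>k < j\<close> both sides are 0; otherwise
    \<open>(-N)_k = (-N)_j (j-N)_(k-j)\<close>.\<close>
  also have "\<dots> = pochhammer (- real N) j *
      (if k < j then 0 else (-1) ^ j * multi_poch_minus d x \<delta> * (pochhammer (real j - real N) (k - j) / fact (k - j)))"
    unfolding pochhammer_minus_nat_over_fact using pochhammer_product[of j k "- real N"] by simp
  finally show ?thesis unfolding s by simp
qed

section \<open>Polynomials on the grid\<close>

lemma grid_polys_cong:
  "f \<in> grid_polys d N n \<Longrightarrow> (\<And>x. x \<in> simplex_grid d N \<Longrightarrow> f x = g x) \<Longrightarrow> g \<in> grid_polys d N n"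
  unfolding grid_polys_def by auto

lemma grid_polys_combine:
  assumes "f \<in> grid_polys d N n" "g \<in> grid_polys d N n"
  shows "(\<lambda>x. a * f x + b * g x) \<in> grid_polys d N n"
proof -
  obtain p q where
    p: "\<forall>x\<in>simplex_grid d N. f x = (\<Sum>\<beta>\<in>exponents_upto d n. p \<beta> * (\<Prod>i<d. real (x i) ^ \<beta> i))" and
    q: "\<forall>x\<in>simplex_grid d N. g x = (\<Sum>\<beta>\<in>exponents_upto d n. q \<beta> * (\<Prod>i<d. real (x i) ^ \<beta> i))"
    using assms unfolding grid_polys_def by blast
  have "\<forall>x\<in>simplex_grid d N. a * f x + b * g x =
      (\<Sum>\<beta>\<in>exponents_upto d n. (a * p \<beta> + b * q \<beta>) * (\<Prod>i<d. real (x i) ^ \<beta> i))"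
    using p q by (simp add: sum_distrib_left sum.distrib algebra_simps)
  then show ?thesis
    unfolding grid_polys_def by (intro CollectI exI[of _ "\<lambda>\<beta>. a * p \<beta> + b * q \<beta>"])
qed

lemma grid_polys_zero: "(\<lambda>x. 0) \<in> grid_polys d N n"
  unfolding grid_polys_def by (auto intro!: exI[of _ "\<lambda>_. 0"])

lemma grid_polys_scale: "f \<in> grid_polys d N n \<Longrightarrow> (\<lambda>x. a * f x) \<in> grid_polys d N n"
  using grid_polys_combine[of f d N n f a 0] by simp

lemma grid_polys_sum:
  assumes "\<And>i. i \<in> A \<Longrightarrow> f i \<in> grid_polys d N n"
  shows "(\<lambda>x. \<Sum>i\<in>A. f i x) \<in> grid_polys d N n"
  using assms
proof (induction A rule: infinite_finite_induct)
  case (insert i A)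
  with grid_polys_combine[of "f i" d N n "\<lambda>x. \<Sum>i\<in>A. f i x" 1 1] show ?case by simp
qed (simp_all add: grid_polys_zero)

lemma grid_polys_monomial:
  assumes "\<beta> \<in> exponents_upto d n"
  shows "(\<lambda>x. \<Prod>i<d. real (x i) ^ \<beta> i) \<in> grid_polys d N n"
  unfolding grid_polys_def using assms
  by (auto intro!: exI[of _ "\<lambda>\<gamma>. if \<gamma> = \<beta> then 1 else 0"]
      simp: if_distrib[of "\<lambda>c. c * _"] finite_exponents_upto cong: if_cong)

lemma grid_polys_one: "(\<lambda>x. 1) \<in> grid_polys d N n"
  using grid_polys_monomial[of "\<lambda>_. 0" d n N] by (simp add: exponents_upto_def)

text \<open>By linearity in \<open>f\<close>, a multiplication operator need only be checked on
  monomials. The factor 1 yields monotonicity in the degree, a coordinate yields the degree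
  shift.\<close>

lemma grid_polys_expand:
  assumes "f \<in> grid_polys d N n"
    and "\<And>\<beta>. \<beta> \<in> exponents_upto d n \<Longrightarrow> (\<lambda>x. F x * (\<Prod>i<d. real (x i) ^ \<beta> i)) \<in> grid_polys d N m"
  shows "(\<lambda>x. F x * f x) \<in> grid_polys d N m"
proof -
  obtain c where c: "\<forall>x\<in>simplex_grid d N. f x = (\<Sum>\<beta>\<in>exponents_upto d n. c \<beta> * (\<Prod>i<d. real (x i) ^ \<beta> i))"
    using assms(1) unfolding grid_polys_def by blast
  have "(\<lambda>x. \<Sum>\<beta>\<in>exponents_upto d n. c \<beta> * (F x * (\<Prod>i<d. real (x i) ^ \<beta> i))) \<in> grid_polys d N m"
    by (intro grid_polys_sum grid_polys_scale assms(2))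
  then show ?thesis
    by (rule grid_polys_cong) (simp add: c sum_distrib_left algebra_simps)
qed

lemma grid_polys_mono:
  assumes "f \<in> grid_polys d N n" "n \<le> m" shows "f \<in> grid_polys d N m"
proof -
  have "(\<lambda>x. 1 * f x) \<in> grid_polys d N m"
    using assms(2) by (intro grid_polys_expand[OF assms(1)])
      (auto intro!: grid_polys_monomial simp: exponents_upto_def)
  then show ?thesis by simp
qed

lemma grid_polys_mult_coordinate:
  assumes f: "f \<in> grid_polys d N n" and "i \<le> d"
  shows "(\<lambda>x. real (x i) * f x) \<in> grid_polys d N (Suc n)"
proof -
  have inner: "(\<lambda>x. real (x j) * f x) \<in> grid_polys d N (Suc n)" if j: "j < d" for j
  proof (rule grid_polys_expand[OF f])
    fix \<beta> assume \<beta>: "\<beta> \<in> exponents_upto d n"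
    have "(\<Sum>i<d. (\<beta>(j := Suc (\<beta> j))) i) = Suc (\<Sum>i<d. \<beta> i)"
      using j by (simp add: sum.remove[of "{..<d}" j])
    then have "\<beta>(j := Suc (\<beta> j)) \<in> exponents_upto d (Suc n)"
      using \<beta> j by (auto simp: exponents_upto_def)
    from grid_polys_monomial[OF this, of N]
    show "(\<lambda>x. real (x j) * (\<Prod>i<d. real (x i) ^ \<beta> i)) \<in> grid_polys d N (Suc n)"
      using j by (simp add: prod.remove[of "{..<d}" j] mult.assoc)
  qed
  show ?thesis
  proof (cases "i < d")
    case False
    with \<open>i \<le> d\<close> have "i = d" by simp
    \<comment> \<open>The last coordinate is no polynomial variable, but on the grid it equals
      \<open>N\<close> minus the sum of the others, which has degree 1.\<close>
    have "(\<lambda>x. real N * f x + (-1) * (\<Sum>j<d. real (x j) * f x)) \<in> grid_polys d N (Suc n)"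
      by (rule grid_polys_combine[OF grid_polys_mono[OF f] grid_polys_sum]) (auto intro: inner)
    then show ?thesis
      unfolding \<open>i = d\<close>
    proof (rule grid_polys_cong)
      fix x assume "x \<in> simplex_grid d N"
      then have "real (\<Sum>i\<le>d. x i) = real N" by (simp add: simplex_grid_def)
      then have "real (x d) = real N - (\<Sum>i<d. real (x i))"
        by (simp flip: lessThan_Suc_atMost)
      then show "real N * f x + (-1) * (\<Sum>j<d. real (x j) * f x) = real (x d) * f x"
        by (simp only: left_diff_distrib sum_distrib_right)
    qed
  qed (use inner in blast)
qed

lemma grid_polys_mult_pochhammer:
  assumes "f \<in> grid_polys d N n" "i \<le> d"
  shows "(\<lambda>x. pochhammer (- real (x i)) k * f x) \<in> grid_polys d N (n + k)"
proof (induction k)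
  case (Suc k)
  from grid_polys_combine[OF grid_polys_mult_coordinate[OF Suc \<open>i \<le> d\<close>] grid_polys_mono[OF Suc],
      of "-1" "real k"]
  show ?case by (simp add: pochhammer_Suc algebra_simps)
qed (use assms in simp)

lemma multi_poch_minus_grid_polys:
  assumes "(\<Sum>i\<le>d. \<gamma> i) \<le> n"
  shows "(\<lambda>x. multi_poch_minus d x \<gamma>) \<in> grid_polys d N n"
proof -
  have "A \<subseteq> {..d} \<Longrightarrow> (\<lambda>x. \<Prod>i\<in>A. pochhammer (- real (x i)) (\<gamma> i)) \<in> grid_polys d N (\<Sum>i\<in>A. \<gamma> i)"
    if "finite A" for A
    using that
  proof (induction A rule: finite_induct)
    case (insert i A)
    then show ?case
      using grid_polys_mult_pochhammer[of _ d N "\<Sum>i\<in>A. \<gamma> i" i "\<gamma> i"] by (simp add: add.commute)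
  qed (simp add: grid_polys_one)
  from grid_polys_mono[OF this assms] show ?thesis
    unfolding multi_poch_minus_def by simp
qed

text \<open>An inductive description of the span lets statements linear in \<open>f\<close> be
  proved by rule induction. The generators involve all \<open>d + 1\<close> coordinates, to match
  \<open>calF\<close>; they need not be independent on the grid.\<close>

inductive_set falling_span :: "nat \<Rightarrow> nat \<Rightarrow> ((nat \<Rightarrow> nat) \<Rightarrow> real) set" for d n where
  generator: "(\<Sum>i\<le>d. \<gamma> i) \<le> n \<Longrightarrow> (\<lambda>x. multi_poch_minus d x \<gamma>) \<in> falling_span d n"
| combine: "f \<in> falling_span d n \<Longrightarrow> g \<in> falling_span d n \<Longrightarrow> (\<lambda>x. a * f x + b * g x) \<in> falling_span d n"

lemma falling_span_mono: "f \<in> falling_span d n \<Longrightarrow> n \<le> m \<Longrightarrow> f \<in> falling_span d m"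
  by (induction rule: falling_span.induct) (auto intro: falling_span.intros)

lemma falling_span_one: "(\<lambda>x. 1) \<in> falling_span d n"
  using falling_span.generator[of "\<lambda>_. 0" d n] by (simp add: multi_poch_minus_def)

lemma falling_span_mult_coordinate:
  assumes "f \<in> falling_span d n" and i: "i \<le> d"
  shows "(\<lambda>x. real (x i) * f x) \<in> falling_span d (Suc n)"
  using assms(1)
proof (induction rule: falling_span.induct)
  case (generator \<gamma>)
  let ?\<gamma>' = "\<gamma>(i := Suc (\<gamma> i))"
  have "(\<Sum>k\<le>d. ?\<gamma>' k) = Suc (\<Sum>k\<le>d. \<gamma> k)"
    using i by (simp add: sum.remove[of "{..d}" i])
  with generator have "(\<lambda>x. multi_poch_minus d x \<gamma>) \<in> falling_span d (Suc n)"
    "(\<lambda>x. multi_poch_minus d x ?\<gamma>') \<in> falling_span d (Suc n)"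
    by (auto intro!: falling_span.generator)
  \<comment> \<open>The coefficients come from
    \<open>x (-x)_g = g (-x)_g - (-x)_(g+1)\<close>.\<close>
  from falling_span.combine[OF this, of "real (\<gamma> i)" "-1"] show ?case
    using i by (simp add: multi_poch_minus_def prod.remove[of "{..d}" i] pochhammer_Suc algebra_simps)
next
  case (combine f g a b)
  from falling_span.combine[OF combine.IH, of a b] show ?case
    by (simp add: algebra_simps)
qed

lemma falling_span_monomial:
  assumes "\<beta> \<in> exponents_upto d n"
  shows "(\<lambda>x. \<Prod>i<d. real (x i) ^ \<beta> i) \<in> falling_span d n"
proof -
  have pow: "(\<lambda>x. real (x i) ^ k * f x) \<in> falling_span d (n + k)"
    if "f \<in> falling_span d n" "i \<le> d" for f n i k
  proof (induction k)
    case (Suc k)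
    from falling_span_mult_coordinate[OF Suc \<open>i \<le> d\<close>] show ?case by (simp add: mult.assoc)
  qed (use that in simp)
  have prod: "A \<subseteq> {..d} \<Longrightarrow> (\<lambda>x. \<Prod>i\<in>A. real (x i) ^ \<beta> i) \<in> falling_span d (\<Sum>i\<in>A. \<beta> i)"
    if "finite A" for A
    using that
  proof (induction A rule: finite_induct)
    case (insert i A)
    then show ?case using pow[of _ "\<Sum>i\<in>A. \<beta> i" i "\<beta> i"] by (simp add: add.commute)
  qed (simp add: falling_span_one)
  have "{..<d} \<subseteq> {..d}" by auto
  from falling_span_mono[OF prod[OF finite_lessThan this], of n] assms show ?thesis
    by (simp add: exponents_upto_def)
qed

lemma grid_polys_falling_span:
  assumes "f \<in> grid_polys d N n"
  obtains h where "h \<in> falling_span d n" "\<And>x. x \<in> simplex_grid d N \<Longrightarrow> f x = h x"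
proof -
  obtain c where c: "\<forall>x\<in>simplex_grid d N. f x = (\<Sum>\<beta>\<in>exponents_upto d n. c \<beta> * (\<Prod>i<d. real (x i) ^ \<beta> i))"
    using assms unfolding grid_polys_def by blast
  have "A \<subseteq> exponents_upto d n \<Longrightarrow> (\<lambda>x. \<Sum>\<beta>\<in>A. c \<beta> * (\<Prod>i<d. real (x i) ^ \<beta> i)) \<in> falling_span d n"
    if "finite A" for A
    using that
  proof (induction A rule: finite_induct)
    case empty
    \<comment> \<open>The zero function is obtained as \<open>0 * 1 + 0 * 1\<close>.\<close>
    show ?case using falling_span.combine[OF falling_span_one falling_span_one, of 0 0] by simp
  next
    case (insert \<beta> A)
    then have "(\<lambda>x. \<Prod>i<d. real (x i) ^ \<beta> i) \<in> falling_span d n"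
      "(\<lambda>x. \<Sum>\<beta>\<in>A. c \<beta> * (\<Prod>i<d. real (x i) ^ \<beta> i)) \<in> falling_span d n"
      by (auto intro: falling_span_monomial)
    from falling_span.combine[OF this, of "c \<beta>" 1] show ?case
      using insert.hyps by simp
  qed
  from that[OF this[OF finite_exponents_upto order_refl]] c show ?thesis by blast
qed

section \<open>The kernel\<close>

locale krawtchouk =
  fixes d N :: nat and \<rho> :: "nat \<Rightarrow> real"
  assumes rho_pos: "i < d \<Longrightarrow> 0 < \<rho> i" and sum_rho: "(\<Sum>i<d. \<rho> i) < 1"
begin

abbreviation "grid \<equiv> simplex_grid d N"
abbreviation "r \<equiv> bold_rho d \<rho>"
abbreviation "kinner \<equiv> krawtchouk_inner d \<rho> N"
abbreviation "degree_of \<gamma> \<equiv> \<Sum>i\<le>d. \<gamma> i"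

lemma bold_rho_pos: "0 < r i"
  using rho_pos sum_rho by (simp add: bold_rho_def)

lemma sum_bold_rho: "(\<Sum>i\<le>d. r i) = 1"
  by (simp add: bold_rho_def flip: lessThan_Suc_atMost)

lemma rho_power_pos: "0 < rho_power d \<rho> \<gamma>"
  unfolding rho_power_def by (intro prod_pos zero_less_power ballI bold_rho_pos)

lemma multi_fact_pos: "0 < multi_fact d \<gamma>"
  unfolding multi_fact_def by (intro prod_pos) simp

section \<open>The Krawtchouk inner product and its orthogonal spaces\<close>

lemma inner_cong:
  "(\<And>x. x \<in> grid \<Longrightarrow> f x = f' x) \<Longrightarrow> (\<And>x. x \<in> grid \<Longrightarrow> g x = g' x) \<Longrightarrow> kinner f g = kinner f' g'"
  unfolding krawtchouk_inner_def by (intro arg_cong[of _ _ "(*) _"] sum.cong) auto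

lemma inner_commute: "kinner f g = kinner g f"
  by (simp add: krawtchouk_inner_def mult.commute)

lemma inner_combine_left: "kinner (\<lambda>x. a * f x + b * g x) h = a * kinner f h + b * kinner g h"
  unfolding krawtchouk_inner_def by (simp add: sum_distrib_left sum.distrib algebra_simps)

lemma inner_sum_left: "kinner (\<lambda>x. \<Sum>i\<in>A. f i x) h = (\<Sum>i\<in>A. kinner (f i) h)"
  unfolding krawtchouk_inner_def sum_distrib_left sum_distrib_right by (rule sum.swap)

lemma inner_scale_left: "kinner (\<lambda>x. a * f x) h = a * kinner f h"
  using inner_combine_left[of a f 0 f h] by simp

lemma inner_diff_left: "kinner (\<lambda>x. f x - g x) h = kinner f h - kinner g h"
  using inner_combine_left[of 1 f "-1" g h] by simp

text \<open>All weights are strictly positive, so the form is definite on the grid. Both the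
  uniqueness of the kernel and the reproducing property end with this fact.\<close>

lemma inner_self_zeroD:
  assumes "kinner f f = 0" "x \<in> grid" shows "f x = 0"
proof -
  have w: "0 < rho_power d \<rho> \<alpha> / multi_fact d \<alpha>" for \<alpha>
    using rho_power_pos multi_fact_pos by simp
  let ?t = "\<lambda>\<alpha>. f \<alpha> * f \<alpha> * (rho_power d \<rho> \<alpha> / multi_fact d \<alpha>)"
  have "0 \<le> ?t \<alpha>" for \<alpha>
    by (rule mult_nonneg_nonneg[OF zero_le_square less_imp_le[OF w]])
  moreover have "(\<Sum>\<alpha>\<in>grid. ?t \<alpha>) = 0"
    using assms(1) by (simp add: krawtchouk_inner_def)
  ultimately have "?t x = 0"
    using assms(2) sum_nonneg_eq_0_iff[of grid ?t] finite_simplex_grid by blast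
  then show ?thesis
    using rho_power_pos[of x] multi_fact_pos[of x] by simp
qed

lemma krawtchouk_space_combine:
  assumes "f \<in> krawtchouk_space d \<rho> N n" "g \<in> krawtchouk_space d \<rho> N n"
  shows "(\<lambda>x. a * f x + b * g x) \<in> krawtchouk_space d \<rho> N n"
  using assms unfolding krawtchouk_space_def by (auto simp: inner_combine_left grid_polys_combine)

lemma krawtchouk_space_diff:
  "f \<in> krawtchouk_space d \<rho> N n \<Longrightarrow> g \<in> krawtchouk_space d \<rho> N n \<Longrightarrow>
    (\<lambda>x. f x - g x) \<in> krawtchouk_space d \<rho> N n"
  using krawtchouk_space_combine[of f n g 1 "-1"] by simp

lemma krawtchouk_space_cong:
  assumes "f \<in> krawtchouk_space d \<rho> N n" "\<And>x. x \<in> grid \<Longrightarrow> f x = g x"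
  shows "g \<in> krawtchouk_space d \<rho> N n"
  using assms grid_polys_cong[of f d N n g] inner_cong[of f g] unfolding krawtchouk_space_def by auto

lemma krawtchouk_space_sum:
  assumes "\<And>i. i \<in> A \<Longrightarrow> f i \<in> krawtchouk_space d \<rho> N n"
  shows "(\<lambda>x. \<Sum>i\<in>A. c i * f i x) \<in> krawtchouk_space d \<rho> N n"
  using assms unfolding krawtchouk_space_def
  by (auto simp: inner_sum_left inner_scale_left intro!: grid_polys_sum grid_polys_scale)

section \<open>Uniqueness of the reproducing kernel\<close>

lemma reproducing_kernel_unique:
  assumes "is_reproducing_kernel d \<rho> N n P" "is_reproducing_kernel d \<rho> N n P'" "x \<in> grid" "y \<in> grid"
  shows "P x y = P' x y"
proof -
  define D where "D = (\<lambda>y. P x y - P' x y)"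
  \<comment> \<open>\<open>D\<close> is itself an admissible test function, and both kernels
    reproduce it at \<open>x\<close>; subtracting gives norm 0.\<close>
  have "D \<in> krawtchouk_space d \<rho> N n"
    using assms unfolding D_def is_reproducing_kernel_def by (auto intro: krawtchouk_space_diff)
  then have "kinner (\<lambda>y. P x y) D = D x" "kinner (\<lambda>y. P' x y) D = D x"
    using assms unfolding is_reproducing_kernel_def by blast+
  then have "kinner D D = 0"
    by (subst D_def) (simp add: inner_diff_left)
  from inner_self_zeroD[OF this \<open>y \<in> grid\<close>] show ?thesis by (simp add: D_def)
qed

lemma krawtchouk_kernel_eq:
  assumes P: "is_reproducing_kernel d \<rho> N n P" and xy: "x \<in> grid" "y \<in> grid"
  shows "krawtchouk_kernel d \<rho> N n x y = P x y"
proof -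
  \<comment> \<open>Uniqueness holds only for values on the grid, whereas \<open>THE\<close> asks
    for equality of total functions; hence the truncation to 0.\<close>
  define P0 where "P0 = (\<lambda>x y. if x \<in> grid \<and> y \<in> grid then P x y else 0)"
  have P0: "is_reproducing_kernel d \<rho> N n P0"
    unfolding is_reproducing_kernel_def
  proof (intro conjI ballI)
    fix z assume z: "z \<in> grid"
    then have "(\<lambda>y. P z y) \<in> krawtchouk_space d \<rho> N n" "(\<lambda>x. P x z) \<in> krawtchouk_space d \<rho> N n"
      using P by (auto simp: is_reproducing_kernel_def)
    then show "(\<lambda>y. P0 z y) \<in> krawtchouk_space d \<rho> N n" "(\<lambda>x. P0 x z) \<in> krawtchouk_space d \<rho> N n"
      by - (erule krawtchouk_space_cong, simp add: P0_def z)+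
    fix Q assume "Q \<in> krawtchouk_space d \<rho> N n"
    then have "kinner (\<lambda>y. P z y) Q = Q z"
      using P z by (auto simp: is_reproducing_kernel_def)
    moreover have "kinner (\<lambda>y. P0 z y) Q = kinner (\<lambda>y. P z y) Q"
      using z by (intro inner_cong) (simp_all add: P0_def)
    ultimately show "kinner (\<lambda>y. P0 z y) Q = Q z" by simp
  qed
  have "krawtchouk_kernel d \<rho> N n = P0"
    unfolding krawtchouk_kernel_def
  proof (rule the_equality)
    fix R assume R: "is_reproducing_kernel d \<rho> N n R \<and> (\<forall>x y. x \<notin> grid \<or> y \<notin> grid \<longrightarrow> R x y = 0)"
    show "R = P0"
    proof (intro ext)
      fix x y show "R x y = P0 x y"
        using reproducing_kernel_unique[OF conjunct1[OF R] P0, of x y] R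
        by (cases "x \<in> grid \<and> y \<in> grid") (auto simp: P0_def)
    qed
  qed (use P0 in \<open>auto simp: P0_def\<close>)
  then show ?thesis using xy by (simp add: P0_def)
qed

section \<open>Integrals of \<open>calF\<close> against products of Pochhammer symbols\<close>

abbreviation "sub_indices \<beta> \<equiv> Pi\<^sub>E {..d} (\<lambda>i. {..\<beta> i :: nat})"

text \<open>Binomials from the product rule, together with what remains of
  \<open>\<rho>^(\<gamma>+\<beta>-\<delta>)\<close> once \<open>\<rho>^\<gamma>\<close> has
  cancelled against the denominator in \<open>calF\<close>.\<close>

definition split_coeff :: "(nat \<Rightarrow> nat) \<Rightarrow> (nat \<Rightarrow> nat) \<Rightarrow> real" where
  "split_coeff \<beta> \<delta> = (\<Prod>i\<le>d. real (\<beta> i choose \<delta> i) * r i ^ (\<beta> i - \<delta> i))"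

lemma multi_poch_minus_mult:
  "multi_poch_minus d \<alpha> \<gamma> * multi_poch_minus d \<alpha> \<beta> =
    (\<Sum>\<delta>\<in>sub_indices \<beta>. (\<Prod>i\<le>d. real (\<beta> i choose \<delta> i)) * multi_poch_minus d \<gamma> \<delta> *
      multi_poch_minus d \<alpha> (\<lambda>i. \<gamma> i + \<beta> i - \<delta> i))"
  unfolding multi_poch_minus_def prod.distrib[symmetric] pochhammer_mult_pochhammer
  by (subst prod_sum_PiE) auto

lemma multi_poch_minus_moment:
  "fact N * (\<Sum>\<alpha>\<in>grid. multi_poch_minus d \<alpha> e * (rho_power d \<rho> \<alpha> / multi_fact d \<alpha>)) =
    pochhammer (- real N) (degree_of e) * (\<Prod>i\<le>d. r i ^ e i)"
  unfolding sum_simplex_grid_moment[OF sum_bold_rho, symmetric]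
  by (simp add: multi_poch_minus_def rho_power_def multi_fact_def prod.distrib prod_dividef)

text \<open>Two summations are carried out in turn: the one over the integration variable by the
  moment formula, after the product rule has linearized
  \<open>(-\<alpha>)_\<gamma> (-\<alpha>)_\<beta>\<close>, and then the one over
  \<open>\<gamma>\<close> by \<open>sum_simplex_grid_pochhammers\<close>.\<close>

lemma inner_calF_multi_poch_minus:
  assumes x: "x \<in> grid" and m: "degree_of \<beta> \<le> N"
  shows "kinner (calF d \<rho> k x) (\<lambda>y. multi_poch_minus d y \<beta>) =
    (\<Sum>\<delta>\<in>sub_indices \<beta>. split_coeff \<beta> \<delta> * multi_poch_minus d x \<delta> / pochhammer (- real N) (degree_of \<delta>) *
      (pochhammer (- real N) k * pochhammer (- real k) (degree_of \<delta>) / fact k *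
       pochhammer (- real N) (k + (degree_of \<beta> - degree_of \<delta>))))"
proof -
  let ?w = "\<lambda>\<alpha>. rho_power d \<rho> \<alpha> / multi_fact d \<alpha>"
  let ?N = "\<lambda>\<delta>. pochhammer (- real N) (k + (degree_of \<beta> - degree_of \<delta>))"
  have le: "\<delta> i \<le> \<beta> i" if "\<delta> \<in> sub_indices \<beta>" "i \<le> d" for \<delta> i
    using that by (auto simp: PiE_def Pi_def)
  have deg: "degree_of (\<lambda>i. \<gamma> i + \<beta> i - \<delta> i) = k + (degree_of \<beta> - degree_of \<delta>)"
    if "\<gamma> \<in> simplex_grid d k" "\<delta> \<in> sub_indices \<beta>" for \<gamma> \<delta>
  proof -
    have "degree_of (\<lambda>i. \<gamma> i + \<beta> i - \<delta> i) = degree_of (\<lambda>i. \<gamma> i + (\<beta> i - \<delta> i))"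
      using le[OF that(2)] by (intro sum.cong) auto
    also have "\<dots> = k + degree_of (\<lambda>i. \<beta> i - \<delta> i)"
      using that(1) by (simp add: sum.distrib simplex_grid_def)
    also have "degree_of (\<lambda>i. \<beta> i - \<delta> i) = degree_of \<beta> - degree_of \<delta>"
      using le[OF that(2)] by (intro sum_subtractf_nat) auto
    finally show ?thesis .
  qed
  have moment: "fact N * (\<Sum>\<alpha>\<in>grid. multi_poch_minus d \<alpha> \<gamma> * multi_poch_minus d \<alpha> \<beta> * ?w \<alpha>) =
      rho_power d \<rho> \<gamma> * (\<Sum>\<delta>\<in>sub_indices \<beta>. split_coeff \<beta> \<delta> * multi_poch_minus d \<gamma> \<delta> * ?N \<delta>)"
    if \<gamma>: "\<gamma> \<in> simplex_grid d k" for \<gamma>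
  proof -
    have "fact N * (\<Sum>\<alpha>\<in>grid. multi_poch_minus d \<alpha> \<gamma> * multi_poch_minus d \<alpha> \<beta> * ?w \<alpha>) =
        (\<Sum>\<delta>\<in>sub_indices \<beta>. (\<Prod>i\<le>d. real (\<beta> i choose \<delta> i)) * multi_poch_minus d \<gamma> \<delta> *
          (fact N * (\<Sum>\<alpha>\<in>grid. multi_poch_minus d \<alpha> (\<lambda>i. \<gamma> i + \<beta> i - \<delta> i) * ?w \<alpha>)))"
      unfolding multi_poch_minus_mult sum_distrib_left sum_distrib_right
      by (subst sum.swap) (intro sum.cong refl, simp only: mult_ac)
    also have "\<dots> = (\<Sum>\<delta>\<in>sub_indices \<beta>. rho_power d \<rho> \<gamma> * (split_coeff \<beta> \<delta> * multi_poch_minus d \<gamma> \<delta> * ?N \<delta>))"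
    proof (rule sum.cong[OF refl])
      fix \<delta> assume \<delta>: "\<delta> \<in> sub_indices \<beta>"
      have "(\<Prod>i\<le>d. r i ^ (\<gamma> i + \<beta> i - \<delta> i)) = (\<Prod>i\<le>d. r i ^ \<gamma> i * r i ^ (\<beta> i - \<delta> i))"
        using le[OF \<delta>] by (intro prod.cong) (auto simp flip: power_add)
      then show "(\<Prod>i\<le>d. real (\<beta> i choose \<delta> i)) * multi_poch_minus d \<gamma> \<delta> *
          (fact N * (\<Sum>\<alpha>\<in>grid. multi_poch_minus d \<alpha> (\<lambda>i. \<gamma> i + \<beta> i - \<delta> i) * ?w \<alpha>)) =
          rho_power d \<rho> \<gamma> * (split_coeff \<beta> \<delta> * multi_poch_minus d \<gamma> \<delta> * ?N \<delta>)"
        unfolding multi_poch_minus_moment deg[OF \<gamma> \<delta>]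
        by (simp add: split_coeff_def rho_power_def prod.distrib)
    qed
    finally show ?thesis by (simp add: sum_distrib_left)
  qed
  have "kinner (calF d \<rho> k x) (\<lambda>y. multi_poch_minus d y \<beta>) =
      (\<Sum>\<gamma>\<in>simplex_grid d k. multi_poch_minus d x \<gamma> / (rho_power d \<rho> \<gamma> * multi_fact d \<gamma>) *
        (fact N * (\<Sum>\<alpha>\<in>grid. multi_poch_minus d \<alpha> \<gamma> * multi_poch_minus d \<alpha> \<beta> * ?w \<alpha>)))"
    unfolding krawtchouk_inner_def calF_def sum_distrib_left sum_distrib_right
    by (subst sum.swap) (simp add: mult_ac)
  also have "\<dots> = (\<Sum>\<gamma>\<in>simplex_grid d k. multi_poch_minus d x \<gamma> / multi_fact d \<gamma> *
        (\<Sum>\<delta>\<in>sub_indices \<beta>. split_coeff \<beta> \<delta> * multi_poch_minus d \<gamma> \<delta> * ?N \<delta>))"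
  proof (rule sum.cong[OF refl])
    fix \<gamma> assume "\<gamma> \<in> simplex_grid d k"
    from moment[OF this] show "multi_poch_minus d x \<gamma> / (rho_power d \<rho> \<gamma> * multi_fact d \<gamma>) *
        (fact N * (\<Sum>\<alpha>\<in>grid. multi_poch_minus d \<alpha> \<gamma> * multi_poch_minus d \<alpha> \<beta> * ?w \<alpha>)) =
        multi_poch_minus d x \<gamma> / multi_fact d \<gamma> *
        (\<Sum>\<delta>\<in>sub_indices \<beta>. split_coeff \<beta> \<delta> * multi_poch_minus d \<gamma> \<delta> * ?N \<delta>)"
      using rho_power_pos[of \<gamma>] by (simp only:) simp
  qed
  also have "\<dots> = (\<Sum>\<delta>\<in>sub_indices \<beta>. split_coeff \<beta> \<delta> * ?N \<delta> *
      (\<Sum>\<gamma>\<in>simplex_grid d k. multi_poch_minus d x \<gamma> * multi_poch_minus d \<gamma> \<delta> / multi_fact d \<gamma>))"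
    unfolding sum_distrib_left by (subst sum.swap) (simp add: mult_ac)
  also have "\<dots> = (\<Sum>\<delta>\<in>sub_indices \<beta>. split_coeff \<beta> \<delta> * multi_poch_minus d x \<delta> / pochhammer (- real N) (degree_of \<delta>) *
      (pochhammer (- real N) k * pochhammer (- real k) (degree_of \<delta>) / fact k * ?N \<delta>))"
  proof (rule sum.cong[OF refl])
    fix \<delta> assume \<delta>: "\<delta> \<in> sub_indices \<beta>"
    \<comment> \<open>Here the bound \<open>m\<close> enters:
      \<open>|\<delta>| \<le> |\<beta>| \<le> N\<close> permits division by
      \<open>(-N)_|\<delta>|\<close>.\<close>
    have "degree_of \<delta> \<le> degree_of \<beta>" using le[OF \<delta>] by (intro sum_mono) auto
    then have "pochhammer (- real N) (degree_of \<delta>) \<noteq> 0"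
      using m by (intro pochhammer_minus_nat_nonzero) simp
    with sum_simplex_grid_pochhammers[OF x, of \<delta> k]
    show "split_coeff \<beta> \<delta> * ?N \<delta> *
        (\<Sum>\<gamma>\<in>simplex_grid d k. multi_poch_minus d x \<gamma> * multi_poch_minus d \<gamma> \<delta> / multi_fact d \<gamma>) =
        split_coeff \<beta> \<delta> * multi_poch_minus d x \<delta> / pochhammer (- real N) (degree_of \<delta>) *
        (pochhammer (- real N) k * pochhammer (- real k) (degree_of \<delta>) / fact k * ?N \<delta>)"
      by (simp add: nonzero_eq_divide_eq[symmetric] eq_divide_eq mult_ac)
  qed
  finally show ?thesis .
qed

section \<open>The explicit kernel and its reproducing property\<close>

definition explicit_kernel :: "nat \<Rightarrow> (nat \<Rightarrow> nat) \<Rightarrow> (nat \<Rightarrow> nat) \<Rightarrow> real" where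
  "explicit_kernel n x y = pochhammer (- real N) n / fact n *
    (\<Sum>k=0..n. pochhammer (- real n) k / (pochhammer (- real N) k * pochhammer (- real N) k)
               * calF d \<rho> k x y)"

lemma kernel_commute: "explicit_kernel n x y = explicit_kernel n y x"
  by (simp add: explicit_kernel_def calF_def mult.commute)

lemma inner_kernel_multi_poch_minus:
  assumes x: "x \<in> grid" and m: "degree_of \<beta> \<le> N" and n: "n \<le> N"
  shows "kinner (explicit_kernel n x) (\<lambda>y. multi_poch_minus d y \<beta>) =
    pochhammer (- real N) n / fact n *
    (\<Sum>\<delta>\<in>sub_indices \<beta>. split_coeff \<beta> \<delta> * multi_poch_minus d x \<delta> / pochhammer (- real N) (degree_of \<delta>) *
      alt_binomial_sum n (\<lambda>k. pochhammer (- real k) (degree_of \<delta>) *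
        pochhammer (real k - real N) (degree_of \<beta> - degree_of \<delta>)))"
proof -
  \<comment> \<open>Uses \<open>(-n)_k / k! = (-1)^k C(n, k)\<close> and
    \<open>(-N)_(k+l) = (-N)_k (k-N)_l\<close>: both factors \<open>(-N)_k\<close> in the
    denominator cancel, leaving a term of a finite difference.\<close>
  have scalar: "pochhammer (- real n) k / (pochhammer (- real N) k * pochhammer (- real N) k) *
      (pochhammer (- real N) k * p / fact k * pochhammer (- real N) (k + l)) =
      (-1) ^ k * real (n choose k) * (p * pochhammer (real k - real N) l)" if "k \<le> n" for k l and p :: real
    using pochhammer_minus_nat_nonzero[of k N] that n pochhammer_product'[of "- real N" k l]
    by (simp add: pochhammer_minus_nat[of n k])
  have "kinner (explicit_kernel n x) (\<lambda>y. multi_poch_minus d y \<beta>) = pochhammer (- real N) n / fact n *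
      (\<Sum>k=0..n. pochhammer (- real n) k / (pochhammer (- real N) k * pochhammer (- real N) k) *
        kinner (calF d \<rho> k x) (\<lambda>y. multi_poch_minus d y \<beta>))"
    unfolding explicit_kernel_def by (simp only: inner_scale_left inner_sum_left)
  also have "\<dots> = pochhammer (- real N) n / fact n *
      (\<Sum>k=0..n. \<Sum>\<delta>\<in>sub_indices \<beta>.
        split_coeff \<beta> \<delta> * multi_poch_minus d x \<delta> / pochhammer (- real N) (degree_of \<delta>) *
        ((-1) ^ k * real (n choose k) * (pochhammer (- real k) (degree_of \<delta>) *
          pochhammer (real k - real N) (degree_of \<beta> - degree_of \<delta>))))"
    unfolding inner_calF_multi_poch_minus[OF x m] sum_distrib_left[of "pochhammer (- real n) _ / _"]
    by (intro arg_cong[of _ _ "(*) _"] sum.cong refl, subst mult.left_commute, subst scalar) simp_all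
  finally show ?thesis
    unfolding alt_binomial_sum_def sum_distrib_left[of _ _ "{..n}"] by (subst sum.swap) (simp add: atMost_atLeast0)
qed

lemma sub_indices_degree_le: "\<delta> \<in> sub_indices \<beta> \<Longrightarrow> degree_of \<delta> \<le> degree_of \<beta>"
  by (intro sum_mono) (auto simp: PiE_def Pi_def)

text \<open>For every \<open>\<delta>\<close> the differenced polynomial in \<open>k\<close> has
  degree \<open>|\<delta>| + (|\<beta>| - |\<delta>|) = |\<beta>|\<close>, below the order
  \<open>n\<close>.\<close>

lemma inner_kernel_low_degree:
  assumes "x \<in> grid" "n \<le> N" "degree_of \<beta> < n"
  shows "kinner (explicit_kernel n x) (\<lambda>y. multi_poch_minus d y \<beta>) = 0"
proof -
  have "alt_binomial_sum n (\<lambda>k. pochhammer (- real k) (degree_of \<delta>) *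
        pochhammer (real k - real N) (degree_of \<beta> - degree_of \<delta>)) = 0" if "\<delta> \<in> sub_indices \<beta>" for \<delta>
    using sub_indices_degree_le[OF that] assms by (intro alt_binomial_sum_pochhammers) simp
  then show ?thesis
    using assms by (subst inner_kernel_multi_poch_minus) (auto intro!: sum.neutral)
qed

lemma alt_binomial_sum_pochhammer_top: "alt_binomial_sum n (\<lambda>k. pochhammer (- real k) n) = fact n"
proof -
  have "alt_binomial_sum n (\<lambda>k. pochhammer (- real k) n) =
      (\<Sum>k\<in>{n}. (-1) ^ k * real (n choose k) * pochhammer (- real k) n)"
    \<comment> \<open>\<open>(-k)_n\<close> vanishes for \<open>k < n\<close>, so only the term
      \<open>k = n\<close> survives.\<close>
    unfolding alt_binomial_sum_def
    by (rule sum.mono_neutral_right) (auto simp: pochhammer_minus_nat)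
  then show ?thesis by (simp add: pochhammer_minus_nat)
qed

text \<open>The only \<open>\<delta>\<close> of full degree is \<open>\<beta>\<close> itself. The
  coefficients \<open>c\<close> are independent of \<open>x\<close>, so the remainder is a
  polynomial in \<open>x\<close> of degree below \<open>n\<close>.\<close>

lemma inner_kernel_top_degree:
  assumes "n \<le> N" "degree_of \<beta> = n"
  obtains c where "\<And>x. x \<in> grid \<Longrightarrow> kinner (explicit_kernel n x) (\<lambda>y. multi_poch_minus d y \<beta>) =
    multi_poch_minus d x \<beta> + (\<Sum>\<delta> | \<delta> \<in> sub_indices \<beta> \<and> degree_of \<delta> < n. c \<delta> * multi_poch_minus d x \<delta>)"
proof
  define c where "c = (\<lambda>\<delta>. pochhammer (- real N) n / fact n * (split_coeff \<beta> \<delta> / pochhammer (- real N) (degree_of \<delta>) *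
      alt_binomial_sum n (\<lambda>k. pochhammer (- real k) (degree_of \<delta>) *
        pochhammer (real k - real N) (n - degree_of \<delta>))))"
  \<comment> \<open>Members of a \<open>PiE\<close> set are \<open>undefined\<close> beyond
    \<open>d\<close>, so \<open>\<beta>\<close> enters as its restriction;
    \<open>multi_poch_minus\<close> reads only the coordinates up to \<open>d\<close>.\<close>
  let ?\<beta> = "restrict \<beta> {..d}"
  let ?L = "{\<delta> \<in> sub_indices \<beta>. degree_of \<delta> < n}"
  have eq: "\<delta> = ?\<beta>" if \<delta>: "\<delta> \<in> sub_indices \<beta>" and "\<not> degree_of \<delta> < n" for \<delta>
  proof -
    have le: "\<delta> i \<le> \<beta> i" if "i \<in> {..d}" for i using \<delta> that by (auto simp: PiE_def Pi_def)
    have "degree_of \<delta> = degree_of \<beta>"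
      using sub_indices_degree_le[OF \<delta>] assms that by simp
    then have "\<delta> i = \<beta> i" if "i \<in> {..d}" for i
      using sum_mono_inv[of \<delta> "{..d}" \<beta>] le that by simp
    then show ?thesis
      using \<delta> by (auto simp: PiE_def extensional_def fun_eq_iff)
  qed
  have \<beta>: "?\<beta> \<in> sub_indices \<beta>" "degree_of ?\<beta> = n" using assms by auto
  then have split: "sub_indices \<beta> = insert ?\<beta> ?L" using eq by blast
  have fin: "finite (sub_indices \<beta>)" by (intro finite_PiE) auto
  \<comment> \<open>This fixes the normalization: the prefactor \<open>(-N)_n / n!\<close> cancels
    \<open>1 / (-N)_n\<close> and the difference value \<open>n!\<close>.\<close>
  have c\<beta>: "c ?\<beta> = 1"
    unfolding c_def \<beta> using assms pochhammer_minus_nat_nonzero[of n N]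
    by (simp add: alt_binomial_sum_pochhammer_top split_coeff_def)
  fix x assume x: "x \<in> grid"
  have "kinner (explicit_kernel n x) (\<lambda>y. multi_poch_minus d y \<beta>) = (\<Sum>\<delta>\<in>sub_indices \<beta>. c \<delta> * multi_poch_minus d x \<delta>)"
    using assms x by (subst inner_kernel_multi_poch_minus) (auto simp: c_def sum_distrib_left mult_ac)
  also have "\<dots> = c ?\<beta> * multi_poch_minus d x ?\<beta> + (\<Sum>\<delta>\<in>?L. c \<delta> * multi_poch_minus d x \<delta>)"
    using fin \<beta> by (subst split, subst sum.insert) auto
  finally show "kinner (explicit_kernel n x) (\<lambda>y. multi_poch_minus d y \<beta>) =
      multi_poch_minus d x \<beta> + (\<Sum>\<delta>\<in>?L. c \<delta> * multi_poch_minus d x \<delta>)"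
    by (simp add: c\<beta> multi_poch_minus_def)
qed

lemma kernel_grid_polys: "explicit_kernel n x \<in> grid_polys d N n"
  unfolding explicit_kernel_def
proof (intro grid_polys_scale grid_polys_sum)
  fix k assume "k \<in> {0..n}"
  then have "(\<lambda>y. \<Sum>\<gamma>\<in>simplex_grid d k. multi_poch_minus d x \<gamma> / (rho_power d \<rho> \<gamma> * multi_fact d \<gamma>) *
      multi_poch_minus d y \<gamma>) \<in> grid_polys d N n"
    by (intro grid_polys_sum grid_polys_scale multi_poch_minus_grid_polys) (auto simp: simplex_grid_def)
  then show "calF d \<rho> k x \<in> grid_polys d N n"
    by (rule grid_polys_cong) (simp add: calF_def)
qed

lemma kernel_krawtchouk_space:
  assumes "x \<in> grid" "n \<le> N" shows "explicit_kernel n x \<in> krawtchouk_space d \<rho> N n"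
  unfolding krawtchouk_space_def
proof (intro CollectI conjI allI impI ballI kernel_grid_polys)
  fix m g assume m: "m < n" and "g \<in> grid_polys d N m"
  then obtain h where h: "h \<in> falling_span d m" "\<And>x. x \<in> grid \<Longrightarrow> g x = h x"
    by (metis grid_polys_falling_span)
  from h(1) have "kinner (explicit_kernel n x) h = 0"
  proof (induction rule: falling_span.induct)
    case (generator \<gamma>)
    with m assms show ?case by (intro inner_kernel_low_degree) auto
  next
    case (combine f g a b)
    then show ?case
      by (simp add: inner_commute[of "explicit_kernel n x"] inner_combine_left)
  qed
  then show "kinner (explicit_kernel n x) g = 0"
    using inner_cong[of "explicit_kernel n x" "explicit_kernel n x" g h] h(2) by simp
qed

text \<open>By symmetry, the image of any \<open>f\<close> is a finite linear combination of the
  sections \<open>explicit_kernel n \<alpha>\<close>, each of which lies in the space.\<close>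

lemma kernel_apply_krawtchouk_space:
  assumes "n \<le> N" shows "(\<lambda>x. kinner (explicit_kernel n x) f) \<in> krawtchouk_space d \<rho> N n"
proof -
  have "(\<lambda>x. \<Sum>\<alpha>\<in>grid. (fact N * f \<alpha> * (rho_power d \<rho> \<alpha> / multi_fact d \<alpha>)) * explicit_kernel n \<alpha> x)
      \<in> krawtchouk_space d \<rho> N n"
    using assms by (intro krawtchouk_space_sum kernel_krawtchouk_space)
  then show ?thesis
    by (rule krawtchouk_space_cong)
      (simp add: krawtchouk_inner_def sum_distrib_left kernel_commute[of n _ "_::nat \<Rightarrow> nat"] mult_ac)
qed

text \<open>On a generator of degree \<open>n\<close> the kernel acts as the identity modulo lower
  degree; on one of lower degree it gives 0, so the residual is minus the generator. Either way the
  residual has degree below \<open>n\<close>, and \<open>h\<close> is orthogonal to it.\<close>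

lemma kernel_residual_orthogonal:
  assumes n: "n \<le> N" and f: "f \<in> falling_span d n" and h: "h \<in> krawtchouk_space d \<rho> N n"
  shows "kinner (\<lambda>x. kinner (explicit_kernel n x) f - f x) h = 0"
  using f
proof (induction rule: falling_span.induct)
  case (generator \<gamma>)
  have low: "kinner (\<lambda>x. multi_poch_minus d x \<delta>) h = 0" if "degree_of \<delta> < n" for \<delta>
    using h that multi_poch_minus_grid_polys[of \<delta> d "degree_of \<delta>" N]
    by (subst inner_commute) (auto simp: krawtchouk_space_def)
  show ?case
  proof (cases "degree_of \<gamma> = n")
    case True
    obtain c where c: "\<And>x. x \<in> grid \<Longrightarrow> kinner (explicit_kernel n x) (\<lambda>y. multi_poch_minus d y \<gamma>) =
        multi_poch_minus d x \<gamma> + (\<Sum>\<delta> | \<delta> \<in> sub_indices \<gamma> \<and> degree_of \<delta> < n. c \<delta> * multi_poch_minus d x \<delta>)"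
      using that by (rule inner_kernel_top_degree[OF n True])
    have "kinner (\<lambda>x. kinner (explicit_kernel n x) (\<lambda>y. multi_poch_minus d y \<gamma>) - multi_poch_minus d x \<gamma>) h =
        kinner (\<lambda>x. \<Sum>\<delta> | \<delta> \<in> sub_indices \<gamma> \<and> degree_of \<delta> < n. c \<delta> * multi_poch_minus d x \<delta>) h"
      by (intro inner_cong) (simp_all add: c)
    also have "\<dots> = 0"
      by (simp add: inner_sum_left inner_scale_left low)
    finally show ?thesis .
  next
    case False
    with generator have "degree_of \<gamma> < n" by simp
    with n have "kinner (\<lambda>x. kinner (explicit_kernel n x) (\<lambda>y. multi_poch_minus d y \<gamma>) - multi_poch_minus d x \<gamma>) h =
        kinner (\<lambda>x. (-1) * multi_poch_minus d x \<gamma>) h"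
      by (intro inner_cong) (simp_all add: inner_kernel_low_degree)
    also have "\<dots> = 0"
      using \<open>degree_of \<gamma> < n\<close> by (simp only: inner_scale_left low mult_zero_right)
    finally show ?thesis .
  qed
next
  case (combine f g a b)
  have "(\<lambda>x. kinner (explicit_kernel n x) (\<lambda>x. a * f x + b * g x) - (a * f x + b * g x)) =
      (\<lambda>x. a * (kinner (explicit_kernel n x) f - f x) + b * (kinner (explicit_kernel n x) g - g x))"
    by (simp add: inner_commute[of "explicit_kernel n _"] inner_combine_left algebra_simps)
  with combine.IH show ?case by (simp only: inner_combine_left mult_zero_right add_0)
qed

text \<open>The residual \<open>R\<close> lies in the Krawtchouk space and, computed from a
  representative of \<open>Q\<close> in \<open>falling_span\<close>, is orthogonal to that space;
  hence it is orthogonal to itself.\<close>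

lemma kernel_reproduces:
  assumes n: "n \<le> N" and Q: "Q \<in> krawtchouk_space d \<rho> N n" and x: "x \<in> grid"
  shows "kinner (explicit_kernel n x) Q = Q x"
proof -
  obtain f where f: "f \<in> falling_span d n" "\<And>x. x \<in> grid \<Longrightarrow> Q x = f x"
    using Q unfolding krawtchouk_space_def by (auto elim: grid_polys_falling_span)
  define R where "R = (\<lambda>x. kinner (explicit_kernel n x) Q - Q x)"
  have R: "R \<in> krawtchouk_space d \<rho> N n"
    unfolding R_def by (intro krawtchouk_space_diff kernel_apply_krawtchouk_space n Q)
  have "kinner (explicit_kernel n z) Q = kinner (explicit_kernel n z) f" for z
    by (intro inner_cong f(2)) auto
  then have "kinner R R = kinner (\<lambda>x. kinner (explicit_kernel n x) f - f x) R"
    by (intro inner_cong) (auto simp: R_def f(2))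
  also have "\<dots> = 0" by (rule kernel_residual_orthogonal[OF n f(1) R])
  finally show ?thesis using inner_self_zeroD x by (force simp: R_def)
qed

lemma kernel_is_reproducing_kernel: "n \<le> N \<Longrightarrow> is_reproducing_kernel d \<rho> N n (explicit_kernel n)"
  unfolding is_reproducing_kernel_def
  by (simp add: kernel_krawtchouk_space kernel_reproduces kernel_commute[of n _ "_ :: nat \<Rightarrow> nat"])

end

theorem theorem5p3:
  fixes d N n :: nat and \<rho> :: "nat \<Rightarrow> real" and x y :: "nat \<Rightarrow> nat"
  assumes "d \<ge> 1"
    and "\<forall>i<d. 0 < \<rho> i \<and> \<rho> i < 1"
    and "(\<Sum>i<d. \<rho> i) < 1"
    and "N > 0" and "n \<le> N"
    and "x \<in> simplex_grid d N" and "y \<in> simplex_grid d N"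
  shows "krawtchouk_kernel d \<rho> N n x y =
    pochhammer (- real N) n / fact n *
    (\<Sum>k=0..n. pochhammer (- real n) k / (pochhammer (- real N) k * pochhammer (- real N) k)
               * calF d \<rho> k x y)"
proof -
  interpret krawtchouk d N \<rho>
    using assms(2,3) by unfold_locales auto
  show ?thesis
    using krawtchouk_kernel_eq[OF kernel_is_reproducing_kernel[OF \<open>n \<le> N\<close>] assms(6,7)]
    by (simp only: explicit_kernel_def)
qed

end
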